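(* For each $n \geq 0$, the family $\{\textsf{E}_\pi : \pi \in A_n\}$ is a basis of the graded component $\textsf{ParSym}_n = \operatorname{span}_{\mathbbm{k}}\{\textsf{H}_\pi : \pi \in A_n\}$.
   Context: Partition diagrams of order $k$ are set partitions of $\{1,\ldots,k,1',\ldots,k'\}$; $A_k$ is the set of them, $A_0=\{\varnothing\}$. For $\pi$ of order $k$, $\rho$ of order $l$: $\pi\otimes\rho$ has as blocks those of $\pi$ and those of $\rho$ shifted ($i\mapsto i+k$, $i'\mapsto(i+k)'$). A diagram is $\otimes$-irreducible if it is not $\rho^{(1)}\otimes\rho^{(2)}$ with both factors nonempty; every nonempty diagram factors uniquely as a $\otimes$-product of nonempty $\otimes$-irreducible diagrams. For nonempty $\pi,\rho$ (orders $k,l$), $\pi\bullet\rho$ is obtained from $\pi\otimes\rho$ by merging the block containing $k'$ with the block containing $(k+1)'$. Over a field $\mathbbm{k}$, $\textsf{ParSym}$ has basis $\{\textsf{H}_\pi : \pi\in A_i, i\geq0\}$ with product $\textsf{H}_\pi\textsf{H}_\rho=\textsf{H}_{\pi\otimes\rho}$ and unit $\textsf{H}_\varnothing$. For a nonempty $\otimes$-irreducible $\pi$ of order $n$, define $\textsf{E}_\pi=\sum(-1)^{\ell+n}\textsf{H}_{\rho^{(1)}}\cdots\textsf{H}_{\rho^{(\ell)}}$, summed over all tuples $(\rho^{(1)},\ldots,\rho^{(\ell)})$, $\ell\geq1$, of nonempty diagrams with $\rho^{(1)}\bullet\cdots\bullet\rho^{(\ell)}=\pi$; for nonempty $\otimes$-irreducible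 $\pi^{(1)},\ldots,\pi^{(p)}$ set $\textsf{E}_{\pi^{(1)}\otimes\cdots\otimes\pi^{(p)}}=\textsf{E}_{\pi^{(1)}}\cdots\textsf{E}_{\pi^{(p)}}$, and $\textsf{E}_\varnothing=\textsf{H}_\varnothing$. *)

theory Defs
  imports
    Complex_Main
    "HOL-Library.Poly_Mapping"
    "HOL-Library.Disjoint_Sets"
begin

section \<open>Partition diagrams\<close>

text \<open>The vertex \<open>i\<close> is encoded as \<open>Inl i\<close> and the primed vertex \<open>i'\<close> as \<open>Inr i\<close>.\<close>

definition vertices :: "nat \<Rightarrow> (nat + nat) set" where
  "vertices k = {1..k} <+> {1..k}"

definition shift :: "nat \<Rightarrow> nat + nat \<Rightarrow> nat + nat" where
  "shift k = map_sum (\<lambda>i. i + k) (\<lambda>i. i + k)"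

lemma finite_vertices: "finite (vertices k)"
  by (simp add: vertices_def)

lemma card_vertices: "card (vertices k) = 2 * k"
  by (simp add: vertices_def card_Plus)

lemma vertices_simps [simp]:
  "Inl i \<in> vertices k \<longleftrightarrow> 1 \<le> i \<and> i \<le> k"
  "Inr i \<in> vertices k \<longleftrightarrow> 1 \<le> i \<and> i \<le> k"
  by (auto simp: vertices_def)

lemma shift_simps [simp]: "shift k (Inl i) = Inl (i + k)" "shift k (Inr i) = Inr (i + k)"
  by (auto simp: shift_def)

lemma inj_shift: "inj (shift k)"
proof (rule injI)
  fix x y assume "shift k x = shift k y" then show "x = y" by (cases x; cases y) auto
qed

lemma shift_shift: "shift j (shift k x) = shift (k + j) x"
  by (cases x) auto

lemma shift_0: "shift 0 = id"
proof
  fix x show "shift 0 x = id x" by (cases x) auto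
qed

lemma shift_vertices: "shift k ` vertices l = vertices (k + l) - vertices k"
proof (rule set_eqI)
  fix x
  show "x \<in> shift k ` vertices l \<longleftrightarrow> x \<in> vertices (k + l) - vertices k"
  proof
    assume "x \<in> shift k ` vertices l"
    then obtain y where y: "x = shift k y" "y \<in> vertices l" by blast
    then show "x \<in> vertices (k + l) - vertices k" by (cases y) auto
  next
    assume x: "x \<in> vertices (k + l) - vertices k"
    have "x = shift k (case x of Inl i \<Rightarrow> Inl (i - k) | Inr i \<Rightarrow> Inr (i - k))"
      "(case x of Inl i \<Rightarrow> Inl (i - k) | Inr i \<Rightarrow> Inr (i - k)) \<in> vertices l"
      using x by (cases x; force)+
    then show "x \<in> shift k ` vertices l" by blast
  qed
qed

lemma vertices_mono: "k \<le> l \<Longrightarrow> vertices k \<subseteq> vertices l"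
  by (auto simp: vertices_def)

lemma vertices_0: "vertices 0 = {}"
  by (auto simp: vertices_def)

definition raw_order :: "(nat + nat) set set \<Rightarrow> nat" where
  "raw_order P = (THE k. partition_on (vertices k) P)"

lemma raw_order_eqI:
  assumes "partition_on (vertices k) P" shows "raw_order P = k"
  unfolding raw_order_def
proof (rule the_equality)
  show "partition_on (vertices k) P" by (rule assms)
next
  fix j assume j: "partition_on (vertices j) P"
  have "vertices j = vertices k" by (rule trans[OF partition_onD1[OF j] partition_onD1[OF assms, symmetric]])
  then have "card (vertices j) = card (vertices k)" by (rule arg_cong)
  then show "j = k" unfolding card_vertices by simp
qed

definition raw_tensor :: "(nat + nat) set set \<Rightarrow> (nat + nat) set set \<Rightarrow> (nat + nat) set set" where
  "raw_tensor P Q = P \<union> (`) (shift (raw_order P)) ` Q"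

lemma raw_tensor_partition_on:
  assumes P: "partition_on (vertices k) P" and Q: "partition_on (vertices l) Q"
  shows "partition_on (vertices (k + l)) (raw_tensor P Q)"
proof -
  have k: "raw_order P = k" using P by (rule raw_order_eqI)
  have ne: "{} \<notin> Q" using Q by (rule partition_onD3)
  have "partition_on (shift k ` vertices l) ((`) (shift k) ` Q - {{}})"
    by (rule partition_on_inj_image[OF Q]) (rule inj_on_subset[OF inj_shift], simp)
  moreover have "(`) (shift k) ` Q - {{}} = (`) (shift k) ` Q" using ne by auto
  ultimately have Q': "partition_on (vertices (k + l) - vertices k) ((`) (shift k) ` Q)"
    by (simp add: shift_vertices)
  have sub: "vertices k \<subseteq> vertices (k + l)" by (rule vertices_mono) simp
  have "disjoint (P \<union> (`) (shift k) ` Q)"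
    using partition_onD1[OF P] partition_onD1[OF Q']
    by (intro disjoint_union partition_onD2[OF P] partition_onD2[OF Q']) auto
  moreover have "\<Union> (P \<union> (`) (shift k) ` Q) = vertices (k + l)"
    unfolding Union_Un_distrib partition_onD1[OF P, symmetric] partition_onD1[OF Q', symmetric]
    using sub by blast
  ultimately show ?thesis
    unfolding raw_tensor_def k partition_on_def
    using partition_onD3[OF P] partition_onD3[OF Q'] by auto
qed

text \<open>
  The order of a diagram is determined by its set of vertices, so diagrams of all orders
  form a single type.
\<close>

typedef diagram = "{P. \<exists>k. partition_on (vertices k) P}"
  morphisms blocks Abs_diagram
  by (rule exI[of _ "{}"]) (auto intro: exI[of _ 0] simp: vertices_0 partition_on_empty)

setup_lifting type_definition_diagram

lift_definition order :: "diagram \<Rightarrow> nat" is raw_order .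

lemma partition_on_blocks: "partition_on (vertices (order \<pi>)) (blocks \<pi>)"
  by transfer (auto simp: raw_order_eqI)

lemma order_eqI: "partition_on (vertices k) (blocks \<pi>) \<Longrightarrow> order \<pi> = k"
  by transfer (rule raw_order_eqI)

definition A :: "nat \<Rightarrow> diagram set" where
  "A k = {\<pi>. partition_on (vertices k) (blocks \<pi>)}"

lemma A_iff_order: "\<pi> \<in> A k \<longleftrightarrow> order \<pi> = k"
  unfolding A_def using partition_on_blocks order_eqI by blast

lemma finite_A: "finite (A k)"
proof (rule finite_imageD)
  show "finite (blocks ` A k)"
    by (rule finite_subset[OF _ finitely_many_partition_on[OF finite_vertices[of k]]])
      (auto simp: A_def)
  show "inj_on blocks (A k)" by (simp add: inj_on_def blocks_inject)
qed

text \<open>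
  The tensor product of diagrams is the addition of a (non-commutative) monoid, with the empty
  diagram as \<open>0\<close>, because the multiplication of \<^theory>\<open>HOL-Library.Poly_Mapping\<close> is convolution
  with respect to an additive monoid of exponents.
\<close>

instantiation diagram :: monoid_add
begin

lift_definition zero_diagram :: diagram is "{}"
  by (rule exI[of _ 0]) (simp add: vertices_0 partition_on_empty)

lift_definition plus_diagram :: "diagram \<Rightarrow> diagram \<Rightarrow> diagram" is raw_tensor
  using raw_tensor_partition_on by blast

instance
proof
  fix a b c :: diagram
  show "a + b + c = a + (b + c)"
  proof transfer
    fix P Q R :: "(nat + nat) set set"
    assume "\<exists>k. partition_on (vertices k) P" "\<exists>k. partition_on (vertices k) Q"
    then obtain k l where P: "partition_on (vertices k) P" and Q: "partition_on (vertices l) Q"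
      by blast
    show "raw_tensor (raw_tensor P Q) R = raw_tensor P (raw_tensor Q R)"
      using raw_order_eqI[OF P] raw_order_eqI[OF Q] raw_order_eqI[OF raw_tensor_partition_on[OF P Q]]
      by (simp add: raw_tensor_def image_Un image_image shift_shift Un_assoc add.commute)
  qed
  have "raw_order {} = 0"
    by (rule raw_order_eqI) (simp add: vertices_0 partition_on_empty)
  then show "0 + a = a" by transfer (simp add: raw_tensor_def shift_0)
  show "a + 0 = a" by transfer (simp add: raw_tensor_def)
qed

end

abbreviation tensor :: "diagram \<Rightarrow> diagram \<Rightarrow> diagram"  (infixl "\<otimes>" 65) where
  "\<pi> \<otimes> \<rho> \<equiv> \<pi> + \<rho>"

abbreviation empty_diagram :: diagram  ("\<emptyset>") where
  "\<emptyset> \<equiv> 0"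

lemma blocks_tensor: "blocks (\<pi> \<otimes> \<rho>) = blocks \<pi> \<union> (`) (shift (order \<pi>)) ` blocks \<rho>"
  by transfer (simp add: raw_tensor_def)

lemma blocks_empty: "blocks \<emptyset> = {}"
  by transfer simp

lemma order_tensor: "order (\<pi> \<otimes> \<rho>) = order \<pi> + order \<rho>"
  by (rule order_eqI) (metis plus_diagram.rep_eq partition_on_blocks raw_tensor_partition_on)

lemma order_eq_0_iff: "order \<pi> = 0 \<longleftrightarrow> \<pi> = \<emptyset>"
proof
  assume "order \<pi> = 0"
  then have "blocks \<pi> = {}"
    using partition_on_blocks[of \<pi>] by (simp add: vertices_0 partition_on_empty)
  then show "\<pi> = \<emptyset>" by (metis blocks_inject blocks_empty)
next
  assume "\<pi> = \<emptyset>"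
  then show "order \<pi> = 0"
    by (intro order_eqI) (simp add: blocks_empty vertices_0 partition_on_empty)
qed

lemma A_0: "A 0 = {\<emptyset>}"
  by (auto simp: A_iff_order order_eq_0_iff)

definition tensor_irreducible :: "diagram \<Rightarrow> bool" where
  "tensor_irreducible \<pi> \<longleftrightarrow> \<not> (\<exists>\<rho> \<sigma>. \<rho> \<noteq> \<emptyset> \<and> \<sigma> \<noteq> \<emptyset> \<and> \<pi> = \<rho> \<otimes> \<sigma>)"

subsection \<open>The merging product\<close>

definition raw_merge :: "'v \<Rightarrow> 'v \<Rightarrow> 'v set set \<Rightarrow> 'v set set" where
  "raw_merge u v P = {X \<in> P. u \<notin> X \<and> v \<notin> X} \<union> {\<Union> {X \<in> P. u \<in> X \<or> v \<in> X}}"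

lemma raw_merge_partition_on:
  assumes P: "partition_on V P" and u: "u \<in> V"
  shows "partition_on V (raw_merge u v P)"
  unfolding partition_on_def
proof (intro conjI)
  show "\<Union> (raw_merge u v P) = V"
    unfolding partition_onD1[OF P] raw_merge_def by blast
  show "{} \<notin> raw_merge u v P"
    using u partition_onD1[OF P] partition_onD3[OF P] unfolding raw_merge_def by blast
  have d: "X = Y" if "X \<in> P" "Y \<in> P" "x \<in> X" "x \<in> Y" for X Y x
    using partition_onD2[OF P] that unfolding disjoint_def by blast
  show "disjoint (raw_merge u v P)"
    unfolding disjoint_def raw_merge_def using d by blast
qed

text \<open>
  \<open>bullet\<close> is only meaningful for nonempty diagrams; if a factor is empty, it is \<open>\<emptyset>\<close> by
  convention.
\<close>

lift_definition bullet :: "diagram \<Rightarrow> diagram \<Rightarrow> diagram"  (infixr "\<bullet>" 70) is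
  "\<lambda>P Q. if P = {} \<or> Q = {} then {}
         else raw_merge (Inr (raw_order P)) (Inr (raw_order P + 1)) (raw_tensor P Q)"
proof -
  fix P Q :: "(nat + nat) set set"
  assume "\<exists>k. partition_on (vertices k) P" "\<exists>k. partition_on (vertices k) Q"
  then obtain k l where P: "partition_on (vertices k) P" and Q: "partition_on (vertices l) Q"
    by blast
  show "\<exists>j. partition_on (vertices j) (if P = {} \<or> Q = {} then {}
         else raw_merge (Inr (raw_order P)) (Inr (raw_order P + 1)) (raw_tensor P Q))"
  proof (cases "P = {} \<or> Q = {}")
    case True
    then show ?thesis by (auto intro!: exI[of _ 0] simp: vertices_0 partition_on_empty)
  next
    case False
    then have "k \<noteq> 0" using P by (auto simp: vertices_0 partition_on_empty)
    then have "partition_on (vertices (k + l)) (raw_merge (Inr k) (Inr (k + 1)) (raw_tensor P Q))"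
      by (intro raw_merge_partition_on raw_tensor_partition_on P Q) simp
    then show ?thesis unfolding raw_order_eqI[OF P] using False by auto
  qed
qed

lemma blocks_bullet:
  assumes "\<pi> \<noteq> \<emptyset>" "\<rho> \<noteq> \<emptyset>"
  shows "blocks (\<pi> \<bullet> \<rho>) = raw_merge (Inr (order \<pi>)) (Inr (order \<pi> + 1)) (blocks (\<pi> \<otimes> \<rho>))"
  using assms by transfer simp

lemma order_bullet:
  assumes "\<pi> \<noteq> \<emptyset>" "\<rho> \<noteq> \<emptyset>"
  shows "order (\<pi> \<bullet> \<rho>) = order \<pi> + order \<rho>"
proof (rule order_eqI)
  have "order \<pi> \<noteq> 0" using assms order_eq_0_iff by blast
  then show "partition_on (vertices (order \<pi> + order \<rho>)) (blocks (\<pi> \<bullet> \<rho>))"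
    unfolding blocks_bullet[OF assms] order_tensor[symmetric]
    by (intro raw_merge_partition_on partition_on_blocks) (simp add: order_tensor)
qed

lemma raw_merge_rel:
  "(\<exists>X \<in> raw_merge u v P. s \<in> X \<and> t \<in> X) \<longleftrightarrow>
    (\<exists>X \<in> P. s \<in> X \<and> t \<in> X) \<or>
    ((\<exists>X \<in> P. s \<in> X \<and> u \<in> X) \<or> (\<exists>X \<in> P. s \<in> X \<and> v \<in> X)) \<and>
    ((\<exists>X \<in> P. t \<in> X \<and> u \<in> X) \<or> (\<exists>X \<in> P. t \<in> X \<and> v \<in> X))"
proof -
  let ?M = "\<Union> {X \<in> P. u \<in> X \<or> v \<in> X}"
  have M: "a \<in> ?M \<longleftrightarrow> (\<exists>X \<in> P. a \<in> X \<and> u \<in> X) \<or> (\<exists>X \<in> P. a \<in> X \<and> v \<in> X)" for a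
    by auto
  have "(\<exists>X \<in> raw_merge u v P. s \<in> X \<and> t \<in> X) \<longleftrightarrow>
      (\<exists>X \<in> P. u \<notin> X \<and> v \<notin> X \<and> s \<in> X \<and> t \<in> X) \<or> s \<in> ?M \<and> t \<in> ?M"
    unfolding raw_merge_def by (simp only: bex_Un bex_simps) auto
  also have "\<dots> \<longleftrightarrow> (\<exists>X \<in> P. s \<in> X \<and> t \<in> X) \<or> s \<in> ?M \<and> t \<in> ?M"
    by auto
  finally show ?thesis unfolding M .
qed

lemma partition_on_eqI:
  assumes P: "partition_on V P" and Q: "partition_on V Q"
    and rel: "\<And>s t. (\<exists>X \<in> P. s \<in> X \<and> t \<in> X) \<longleftrightarrow> (\<exists>X \<in> Q. s \<in> X \<and> t \<in> X)"
  shows "P = Q"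
proof -
  have "P \<subseteq> Q" if P: "disjoint P" "{} \<notin> P" and Q: "disjoint Q"
    and rel: "\<And>s t. (\<exists>X \<in> P. s \<in> X \<and> t \<in> X) \<longleftrightarrow> (\<exists>X \<in> Q. s \<in> X \<and> t \<in> X)"
    for P Q :: "'a set set"
  proof
    fix X assume X: "X \<in> P"
    then obtain s where s: "s \<in> X" using P by fastforce
    then obtain Y where Y: "Y \<in> Q" "s \<in> Y" using rel[of s s] X by blast
    have u: "X' = X" if "X' \<in> P" "s \<in> X'" for X' using P(1) X s that unfolding disjoint_def by blast
    have w: "Y' = Y" if "Y' \<in> Q" "s \<in> Y'" for Y' using Q Y that unfolding disjoint_def by blast
    have "t \<in> X \<longleftrightarrow> t \<in> Y" for t using rel[of s t] u w X s Y by metis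
    then have "X = Y" by blast
    then show "X \<in> Q" using Y by simp
  qed
  note sub = this
  show ?thesis
  proof (rule subset_antisym)
    show "P \<subseteq> Q"
      by (rule sub[OF partition_onD2[OF P] partition_onD3[OF P] partition_onD2[OF Q] rel])
    show "Q \<subseteq> P"
      by (rule sub[OF partition_onD2[OF Q] partition_onD3[OF Q] partition_onD2[OF P] rel[symmetric]])
  qed
qed

lemma raw_merge_commute:
  assumes P: "partition_on V P" and u: "u \<in> V" and x: "x \<in> V"
  shows "raw_merge u v (raw_merge x y P) = raw_merge x y (raw_merge u v P)"
proof (rule partition_on_eqI)
  note Pu = raw_merge_partition_on[OF P u, of v] and Px = raw_merge_partition_on[OF P x, of y]
  show "partition_on V (raw_merge u v (raw_merge x y P))"
    by (rule raw_merge_partition_on[OF Px u])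
  show "partition_on V (raw_merge x y (raw_merge u v P))"
    by (rule raw_merge_partition_on[OF Pu x])
  fix s t
  define R where "R a b \<longleftrightarrow> (\<exists>X \<in> P. a \<in> X \<and> b \<in> X)" for a b
  have sym: "R a b \<Longrightarrow> R b a" for a b unfolding R_def by blast
  have trans: "R a b \<Longrightarrow> R b c \<Longrightarrow> R a c" for a b c
    using partition_onD2[OF P] unfolding R_def disjoint_def by blast
  have refl: "R u u" "R x x" using u x partition_onD1[OF P] unfolding R_def by blast+
  define M where "M R u v s t \<longleftrightarrow> R s t \<or> (R s u \<or> R s v) \<and> (R t u \<or> R t v)"
    for R :: "'a \<Rightarrow> 'a \<Rightarrow> bool" and u v s t
  have "M (M R x y) u v s t \<Longrightarrow> M (M R u v) x y s t"
    unfolding M_def using sym trans refl by blast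
  moreover have "M (M R u v) x y s t \<Longrightarrow> M (M R x y) u v s t"
    unfolding M_def using sym trans refl by blast
  ultimately have "M (M R x y) u v s t \<longleftrightarrow> M (M R u v) x y s t" by (rule iffI)
  then show "(\<exists>X \<in> raw_merge u v (raw_merge x y P). s \<in> X \<and> t \<in> X) \<longleftrightarrow>
    (\<exists>X \<in> raw_merge x y (raw_merge u v P). s \<in> X \<and> t \<in> X)"
    unfolding raw_merge_rel R_def M_def .
qed

lemma raw_merge_Un:
  assumes "\<forall>X \<in> Q. u \<notin> X \<and> v \<notin> X"
  shows "raw_merge u v (P \<union> Q) = raw_merge u v P \<union> Q"
proof -
  have "{X \<in> P \<union> Q. u \<in> X \<or> v \<in> X} = {X \<in> P. u \<in> X \<or> v \<in> X}"
    "{X \<in> P \<union> Q. u \<notin> X \<and> v \<notin> X} = {X \<in> P. u \<notin> X \<and> v \<notin> X} \<union> Q"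
    using assms by blast+
  then show ?thesis unfolding raw_merge_def by auto
qed

lemma raw_merge_image:
  assumes "inj f"
  shows "(`) f ` raw_merge u v P = raw_merge (f u) (f v) ((`) f ` P)"
proof -
  have "{X \<in> (`) f ` P. f u \<in> X \<or> f v \<in> X} = (`) f ` {X \<in> P. u \<in> X \<or> v \<in> X}"
    "{X \<in> (`) f ` P. f u \<notin> X \<and> f v \<notin> X} = (`) f ` {X \<in> P. u \<notin> X \<and> v \<notin> X}"
    using inj_image_mem_iff[OF assms] by (blast, blast)
  then show ?thesis unfolding raw_merge_def by (simp add: image_Un image_Union)
qed

lemma bullet_assoc:
  assumes ne: "\<pi> \<noteq> \<emptyset>" "\<rho> \<noteq> \<emptyset>" "\<sigma> \<noteq> \<emptyset>"
  shows "(\<pi> \<bullet> \<rho>) \<bullet> \<sigma> = \<pi> \<bullet> (\<rho> \<bullet> \<sigma>)"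
proof -
  define k where "k = order \<pi>"
  define l where "l = order \<rho>"
  have kl: "k \<noteq> 0" "l \<noteq> 0" using ne order_eq_0_iff by (auto simp: k_def l_def)
  have o: "order (\<pi> \<bullet> \<rho>) = k + l" "order (\<pi> \<otimes> \<rho>) = k + l" "order \<pi> = k" "order \<rho> = l"
    using ne by (auto simp: order_bullet order_tensor k_def l_def)
  have ne': "\<pi> \<bullet> \<rho> \<noteq> \<emptyset>" "\<rho> \<bullet> \<sigma> \<noteq> \<emptyset>"
    using kl o(1) order_bullet[OF ne(2,3)] order_eq_0_iff[of "\<pi> \<bullet> \<rho>"]
      order_eq_0_iff[of "\<rho> \<bullet> \<sigma>"] l_def by auto
  let ?W = "blocks (\<pi> \<otimes> \<rho> \<otimes> \<sigma>)"
  have W: "partition_on (vertices (order (\<pi> \<otimes> \<rho> \<otimes> \<sigma>))) ?W" by (rule partition_on_blocks)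
  have "blocks ((\<pi> \<bullet> \<rho>) \<bullet> \<sigma>) =
    raw_merge (Inr (k + l)) (Inr (k + l + 1)) (blocks (\<pi> \<bullet> \<rho>) \<union> (`) (shift (k + l)) ` blocks \<sigma>)"
    by (simp add: blocks_bullet[OF ne'(1) ne(3)] blocks_tensor o)
  also have "blocks (\<pi> \<bullet> \<rho>) \<union> (`) (shift (k + l)) ` blocks \<sigma> = raw_merge (Inr k) (Inr (k + 1)) ?W"
  proof -
    have "Inr k \<notin> shift (k + l) ` Y \<and> Inr (k + 1) \<notin> shift (k + l) ` Y" if "Y \<in> blocks \<sigma>" for Y
    proof -
      have "Y \<subseteq> vertices (order \<sigma>)"
        using that partition_onD1[OF partition_on_blocks[of \<sigma>]] by auto
      then have "shift (k + l) ` Y \<inter> vertices (k + l) = {}"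
        using shift_vertices[of "k + l" "order \<sigma>"] by blast
      moreover have "Inr k \<in> vertices (k + l)" "Inr (k + 1) \<in> vertices (k + l)" using kl by auto
      ultimately show ?thesis by blast
    qed
    then show ?thesis
      unfolding blocks_bullet[OF ne(1,2)] blocks_tensor[of "\<pi> \<otimes> \<rho>" \<sigma>] o
      by (subst raw_merge_Un) auto
  qed
  also have "raw_merge (Inr (k + l)) (Inr (k + l + 1)) (raw_merge (Inr k) (Inr (k + 1)) ?W) =
    raw_merge (Inr k) (Inr (k + 1)) (raw_merge (Inr (k + l)) (Inr (k + l + 1)) ?W)"
    using kl by (intro raw_merge_commute[OF W]) (auto simp: order_tensor o)
  also have "raw_merge (Inr (k + l)) (Inr (k + l + 1)) ?W = blocks (\<pi> \<otimes> (\<rho> \<bullet> \<sigma>))"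
  proof -
    have notin: "Inr (k + l) \<notin> X \<and> Inr (k + l + 1) \<notin> X" if "X \<in> blocks \<pi>" for X
    proof -
      have "X \<subseteq> vertices k" using that partition_onD1[OF partition_on_blocks[of \<pi>]] o by auto
      moreover have "Inr (k + l) \<notin> vertices k" "Inr (k + l + 1) \<notin> vertices k" using kl by auto
      ultimately show ?thesis by blast
    qed
    have "blocks (\<pi> \<otimes> (\<rho> \<bullet> \<sigma>)) =
      raw_merge (Inr (k + l)) (Inr (k + l + 1)) ((`) (shift k) ` blocks (\<rho> \<otimes> \<sigma>)) \<union> blocks \<pi>"
      unfolding blocks_tensor[of \<pi>] blocks_bullet[OF ne(2,3)] raw_merge_image[OF inj_shift] o
      by (simp add: ac_simps)
    also have "\<dots> = raw_merge (Inr (k + l)) (Inr (k + l + 1))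
        ((`) (shift k) ` blocks (\<rho> \<otimes> \<sigma>) \<union> blocks \<pi>)"
      using notin by (subst raw_merge_Un) auto
    finally show ?thesis
      by (simp add: add.assoc blocks_tensor[of \<pi>] o Un_commute)
  qed
  also have "raw_merge (Inr k) (Inr (k + 1)) \<dots> = blocks (\<pi> \<bullet> (\<rho> \<bullet> \<sigma>))"
    by (simp add: blocks_bullet[OF ne(1) ne'(2)] o)
  finally show ?thesis by (simp add: blocks_inject)
qed

text \<open>
  The iterated product of a nonempty list. (The bracketing is immaterial, by associativity of
  \<open>\<bullet>\<close> on nonempty diagrams, see \<open>bullet_assoc\<close> above. The value on \<open>[]\<close> is never used.)
\<close>

fun bullets :: "diagram list \<Rightarrow> diagram" where
  "bullets [] = \<emptyset>"
| "bullets [\<rho>] = \<rho>"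
| "bullets (\<rho> # \<sigma> # \<rho>s) = \<rho> \<bullet> bullets (\<sigma> # \<rho>s)"

definition bullet_factorizations :: "diagram \<Rightarrow> diagram list set" where
  "bullet_factorizations \<pi> = {\<rho>s. \<rho>s \<noteq> [] \<and> (\<forall>\<rho> \<in> set \<rho>s. \<rho> \<noteq> \<emptyset>) \<and> bullets \<rho>s = \<pi>}"

lemma bullets_order:
  "\<rho>s \<noteq> [] \<Longrightarrow> \<forall>\<rho> \<in> set \<rho>s. \<rho> \<noteq> \<emptyset> \<Longrightarrow>
    bullets \<rho>s \<noteq> \<emptyset> \<and> order (bullets \<rho>s) = sum_list (map order \<rho>s)"
proof (induction \<rho>s rule: bullets.induct)
  case (3 \<rho> \<sigma> \<rho>s)
  then have "bullets (\<sigma> # \<rho>s) \<noteq> \<emptyset>" "\<rho> \<noteq> \<emptyset>"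
    "order (bullets (\<sigma> # \<rho>s)) = sum_list (map order (\<sigma> # \<rho>s))" by auto
  then show ?case
    using order_bullet[of \<rho> "bullets (\<sigma> # \<rho>s)"] order_eq_0_iff[of \<rho>]
      order_eq_0_iff[of "\<rho> \<bullet> bullets (\<sigma> # \<rho>s)"] by auto
qed auto

lemma length_le_sum_list_order:
  "\<forall>\<rho> \<in> set \<rho>s. \<rho> \<noteq> \<emptyset> \<Longrightarrow> length \<rho>s \<le> sum_list (map order \<rho>s)"
proof (induction \<rho>s)
  case (Cons \<rho> \<rho>s)
  then have "order \<rho> \<noteq> 0" by (simp add: order_eq_0_iff)
  with Cons show ?case by fastforce
qed simp

lemma finite_bullet_factorizations: "finite (bullet_factorizations \<pi>)"
proof (rule finite_subset)
  let ?D = "\<Union>k \<le> order \<pi>. A k"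
  show "finite {\<rho>s. set \<rho>s \<subseteq> ?D \<and> length \<rho>s \<le> order \<pi>}"
    by (intro finite_lists_length_le) (simp add: finite_A)
  show "bullet_factorizations \<pi> \<subseteq> {\<rho>s. set \<rho>s \<subseteq> ?D \<and> length \<rho>s \<le> order \<pi>}"
  proof
    fix \<rho>s assume "\<rho>s \<in> bullet_factorizations \<pi>"
    then have \<rho>s: "\<rho>s \<noteq> []" "\<forall>\<rho> \<in> set \<rho>s. \<rho> \<noteq> \<emptyset>" "bullets \<rho>s = \<pi>"
      by (auto simp: bullet_factorizations_def)
    have o: "order \<pi> = sum_list (map order \<rho>s)" using bullets_order \<rho>s by blast
    have "order \<rho> \<le> order \<pi>" if "\<rho> \<in> set \<rho>s" for \<rho>
      unfolding o using that by (intro member_le_sum_list) auto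
    then show "\<rho>s \<in> {\<rho>s. set \<rho>s \<subseteq> ?D \<and> length \<rho>s \<le> order \<pi>}"
      using length_le_sum_list_order[OF \<rho>s(2)] o by (auto simp: A_iff_order)
  qed
qed

subsection \<open>Unique factorization\<close>

lemma blocks_tensor_left:
  "blocks \<pi> = {X \<in> blocks (\<pi> \<otimes> \<rho>). X \<subseteq> vertices (order \<pi>)}" (is "_ = ?R")
proof
  show "blocks \<pi> \<subseteq> ?R"
    using partition_onD1[OF partition_on_blocks[of \<pi>]] by (auto simp: blocks_tensor)
  have "\<not> shift (order \<pi>) ` Y \<subseteq> vertices (order \<pi>)" if "Y \<in> blocks \<rho>" for Y
  proof -
    have "Y \<noteq> {}" "Y \<subseteq> vertices (order \<rho>)"
      using that partition_onD1[OF partition_on_blocks[of \<rho>]]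
        partition_onD3[OF partition_on_blocks[of \<rho>]] by auto
    then show ?thesis using shift_vertices[of "order \<pi>" "order \<rho>"] by blast
  qed
  then show "?R \<subseteq> blocks \<pi>" by (auto simp: blocks_tensor)
qed

lemma blocks_tensor_right: "blocks \<rho> = (-`) (shift (order \<pi>)) ` (blocks (\<pi> \<otimes> \<rho>) - blocks \<pi>)"
proof -
  have "blocks \<pi> \<inter> (`) (shift (order \<pi>)) ` blocks \<rho> = {}"
  proof (rule ccontr)
    assume "blocks \<pi> \<inter> (`) (shift (order \<pi>)) ` blocks \<rho> \<noteq> {}"
    then obtain Y where Y: "Y \<in> blocks \<rho>" "shift (order \<pi>) ` Y \<in> blocks \<pi>" by blast
    have "Y \<noteq> {}" "Y \<subseteq> vertices (order \<rho>)" "shift (order \<pi>) ` Y \<subseteq> vertices (order \<pi>)"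
      using Y partition_onD1[OF partition_on_blocks[of \<rho>]]
        partition_onD3[OF partition_on_blocks[of \<rho>]] partition_onD1[OF partition_on_blocks[of \<pi>]]
      by auto
    then show False using shift_vertices[of "order \<pi>" "order \<rho>"] by blast
  qed
  then have "blocks (\<pi> \<otimes> \<rho>) - blocks \<pi> = (`) (shift (order \<pi>)) ` blocks \<rho>"
    by (auto simp: blocks_tensor)
  then show ?thesis by (simp add: image_image inj_vimage_image_eq[OF inj_shift])
qed

lemma tensor_left_cancel: "\<pi> \<otimes> \<rho> = \<pi> \<otimes> \<sigma> \<Longrightarrow> \<rho> = \<sigma>"
  using blocks_tensor_right[of \<rho> \<pi>] blocks_tensor_right[of \<sigma> \<pi>]
  by (simp add: blocks_inject[symmetric])

lemma tensor_prefix: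
  assumes eq: "\<pi> \<otimes> \<rho> = \<sigma> \<otimes> \<tau>" and less: "order \<pi> \<le> order \<sigma>"
  obtains \<kappa> where "\<sigma> = \<pi> \<otimes> \<kappa>"
proof -
  define k where "k = order \<pi>"
  define m where "m = order \<sigma> - order \<pi>"
  define T where "T = blocks \<sigma> - blocks \<pi>"
  have m: "order \<sigma> = k + m" using less by (simp add: k_def m_def)
  have P: "partition_on (vertices k) (blocks \<pi>)" unfolding k_def by (rule partition_on_blocks)
  have S: "partition_on (vertices (k + m)) (blocks \<sigma>)" using partition_on_blocks[of \<sigma>] m by simp
  have "vertices (order \<pi>) \<subseteq> vertices (order \<sigma>)" using less by (rule vertices_mono)
  then have sub: "blocks \<pi> \<subseteq> blocks \<sigma>"
    using blocks_tensor_left[of \<pi> \<rho>] blocks_tensor_left[of \<sigma> \<tau>] eq by auto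
  have dis: "X \<inter> Y = {}" if "X \<in> T" "Y \<in> blocks \<pi>" for X Y
  proof (rule disjointD[OF partition_onD2[OF S]])
    show "X \<in> blocks \<sigma>" "Y \<in> blocks \<sigma>" "X \<noteq> Y" using that sub by (auto simp: T_def)
  qed
  have "partition_on (vertices (k + m) - vertices k) T"
    unfolding partition_on_def
  proof (intro conjI)
    show "\<Union> T = vertices (k + m) - vertices k"
      unfolding partition_onD1[OF P] partition_onD1[OF S] using dis
      by (fastforce simp: T_def)
    show "disjoint T" using partition_onD2[OF S] unfolding T_def disjoint_def by blast
    show "{} \<notin> T" using partition_onD3[OF S] unfolding T_def by blast
  qed
  then have T: "partition_on (shift k ` vertices m) T" by (simp add: shift_vertices)
  have im: "shift k ` (shift k -` X) = X" if "X \<in> T" for X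
  proof -
    have "X \<subseteq> \<Union> T" using that by (rule Union_upper)
    also have "\<dots> = shift k ` vertices m" by (rule partition_onD1[OF T, symmetric])
    finally show ?thesis by (auto simp: image_vimage_eq)
  qed
  have "partition_on (vertices m) ((-`) (shift k) ` T - {{}})"
    using partition_on_vimage[OF T, of "shift k"] by (simp add: inj_vimage_image_eq[OF inj_shift])
  moreover have "(-`) (shift k) ` T - {{}} = (-`) (shift k) ` T"
  proof -
    have "shift k -` X \<noteq> {}" if "X \<in> T" for X
    proof
      assume "shift k -` X = {}"
      then have "X = {}" using im[OF that] by simp
      then show False using that partition_onD3[OF T] by simp
    qed
    then show ?thesis by auto
  qed
  ultimately have K: "partition_on (vertices m) ((-`) (shift k) ` T)" by simp
  define \<kappa> where "\<kappa> = Abs_diagram ((-`) (shift k) ` T)"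
  have \<kappa>: "blocks \<kappa> = (-`) (shift k) ` T"
    unfolding \<kappa>_def using K by (intro Abs_diagram_inverse) auto
  have "blocks (\<pi> \<otimes> \<kappa>) = blocks \<pi> \<union> T"
    unfolding blocks_tensor \<kappa> k_def[symmetric] image_image
    using image_cong[OF refl im, of T "\<lambda>X. X"] by (simp only: image_ident)
  also have "\<dots> = blocks \<sigma>" using sub by (auto simp: T_def)
  finally have "\<sigma> = \<pi> \<otimes> \<kappa>" by (simp add: blocks_inject)
  then show thesis by (rule that)
qed

definition tensor_factors :: "diagram \<Rightarrow> diagram list" where
  "tensor_factors \<pi> =
    (THE \<rho>s. (\<forall>\<rho> \<in> set \<rho>s. \<rho> \<noteq> \<emptyset> \<and> tensor_irreducible \<rho>) \<and> sum_list \<rho>s = \<pi>)"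

lemma tensor_factorization_exists:
  "\<exists>\<rho>s. (\<forall>\<rho> \<in> set \<rho>s. \<rho> \<noteq> \<emptyset> \<and> tensor_irreducible \<rho>) \<and> sum_list \<rho>s = \<pi>"
proof (induction "order \<pi>" arbitrary: \<pi> rule: less_induct)
  case less
  consider "\<pi> = \<emptyset>" | "\<pi> \<noteq> \<emptyset>" "tensor_irreducible \<pi>"
    | \<rho> \<sigma> where "\<rho> \<noteq> \<emptyset>" "\<sigma> \<noteq> \<emptyset>" "\<pi> = \<rho> \<otimes> \<sigma>"
    unfolding tensor_irreducible_def by blast
  then show ?case
  proof cases
    case 1 then show ?thesis by (intro exI[of _ "[]"]) simp
  next
    case 2 then show ?thesis by (intro exI[of _ "[\<pi>]"]) simp
  next
    case (3 \<rho> \<sigma>)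
    then have "order \<rho> < order \<pi>" "order \<sigma> < order \<pi>"
      using order_eq_0_iff[of \<rho>] order_eq_0_iff[of \<sigma>] by (auto simp: order_tensor)
    then obtain rs ss where
      "\<forall>\<rho> \<in> set rs. \<rho> \<noteq> \<emptyset> \<and> tensor_irreducible \<rho>" "sum_list rs = \<rho>"
      "\<forall>\<rho> \<in> set ss. \<rho> \<noteq> \<emptyset> \<and> tensor_irreducible \<rho>" "sum_list ss = \<sigma>"
      using less by metis
    then show ?thesis using 3(3) by (intro exI[of _ "rs @ ss"]) auto
  qed
qed

lemma tensor_factorization_unique:
  assumes "\<forall>\<rho> \<in> set \<rho>s. \<rho> \<noteq> \<emptyset> \<and> tensor_irreducible \<rho>"
    and "\<forall>\<sigma> \<in> set \<sigma>s. \<sigma> \<noteq> \<emptyset> \<and> tensor_irreducible \<sigma>"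
    and "sum_list \<rho>s = sum_list \<sigma>s"
  shows "\<rho>s = \<sigma>s"
  using assms
proof (induction \<rho>s arbitrary: \<sigma>s)
  have pos: "\<sigma> \<otimes> \<tau> \<noteq> \<emptyset>" if "\<sigma> \<noteq> \<emptyset>" for \<sigma> \<tau>
    using that by (metis add_is_0 order_eq_0_iff order_tensor)
  {
    case Nil
    then show ?case by (cases \<sigma>s) (use pos in \<open>auto dest: sym\<close>)
  next
    case (Cons \<rho> \<rho>s)
    then obtain \<sigma> \<sigma>s' where \<sigma>s: "\<sigma>s = \<sigma> # \<sigma>s'"
      by (cases \<sigma>s) (use pos in auto)
    have eq: "\<rho> \<otimes> sum_list \<rho>s = \<sigma> \<otimes> sum_list \<sigma>s'" using Cons.prems \<sigma>s by simp
    have irr: "\<rho> \<noteq> \<emptyset>" "\<sigma> \<noteq> \<emptyset>" "tensor_irreducible \<rho>" "tensor_irreducible \<sigma>"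
      using Cons.prems \<sigma>s by auto
    have "\<rho> = \<sigma>"
    proof (cases "order \<rho> \<le> order \<sigma>")
      case True
      then obtain \<kappa> where "\<sigma> = \<rho> \<otimes> \<kappa>" using tensor_prefix[OF eq] by blast
      then show ?thesis using irr unfolding tensor_irreducible_def by (metis add.right_neutral)
    next
      case False
      then obtain \<kappa> where "\<rho> = \<sigma> \<otimes> \<kappa>" using tensor_prefix[OF eq[symmetric]] by auto
      then show ?thesis using irr unfolding tensor_irreducible_def by (metis add.right_neutral)
    qed
    moreover from this have "sum_list \<rho>s = sum_list \<sigma>s'" using eq tensor_left_cancel by blast
    moreover from this have "\<rho>s = \<sigma>s'"
      using Cons.IH[of \<sigma>s'] Cons.prems(1,2) unfolding \<sigma>s by (meson list.set_intros(2))
    ultimately show ?case unfolding \<sigma>s by blast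
  }
qed

lemma tensor_factors:
  "\<forall>\<rho> \<in> set (tensor_factors \<pi>). \<rho> \<noteq> \<emptyset> \<and> tensor_irreducible \<rho>"
  "sum_list (tensor_factors \<pi>) = \<pi>"
proof -
  have "\<exists>!\<rho>s. (\<forall>\<rho> \<in> set \<rho>s. \<rho> \<noteq> \<emptyset> \<and> tensor_irreducible \<rho>) \<and> sum_list \<rho>s = \<pi>"
    by (rule ex_ex1I[OF tensor_factorization_exists]) (simp add: tensor_factorization_unique)
  from theI'[OF this, folded tensor_factors_def]
  show "\<forall>\<rho> \<in> set (tensor_factors \<pi>). \<rho> \<noteq> \<emptyset> \<and> tensor_irreducible \<rho>"
    "sum_list (tensor_factors \<pi>) = \<pi>" by blast+
qed

lemma tensor_factors_eqI:
  assumes "\<forall>\<rho> \<in> set \<rho>s. \<rho> \<noteq> \<emptyset> \<and> tensor_irreducible \<rho>" "sum_list \<rho>s = \<pi>"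
  shows "tensor_factors \<pi> = \<rho>s"
  by (rule tensor_factorization_unique[OF tensor_factors(1) assms(1)])
    (simp add: tensor_factors(2) assms(2))

section \<open>The algebra ParSym\<close>

text \<open>
  ParSym is the monoid algebra of the monoid of diagrams: the finitely supported functions from
  diagrams to the field, with the convolution product.
\<close>

type_synonym 'k parsym = "diagram \<Rightarrow>\<^sub>0 'k"

definition parsym_scale :: "'k::field \<Rightarrow> 'k parsym \<Rightarrow> 'k parsym" where
  "parsym_scale c p = Poly_Mapping.map ((*) c) p"

lemma lookup_parsym_scale: "Poly_Mapping.lookup (parsym_scale c p) \<pi> = c * Poly_Mapping.lookup p \<pi>"
  by (simp add: parsym_scale_def Poly_Mapping.map.rep_eq when_def)

global_interpretation ParSym: vector_space "parsym_scale :: 'k::field \<Rightarrow> _"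
  by unfold_locales
    (auto intro!: poly_mapping_eqI simp: lookup_parsym_scale lookup_add algebra_simps)

definition H :: "diagram \<Rightarrow> 'k::field parsym" where
  "H \<pi> = Poly_Mapping.single \<pi> 1"

lemma H_mult: "H \<pi> * H \<rho> = H (\<pi> \<otimes> \<rho>)"
  by (simp add: H_def mult_single)

lemma H_empty: "H \<emptyset> = 1"
  by (simp add: H_def)

definition ParSym_component :: "nat \<Rightarrow> 'k::field parsym set" where
  "ParSym_component n = ParSym.span (H ` A n)"

definition E_irr :: "diagram \<Rightarrow> 'k::field parsym" where
  "E_irr \<pi> = (\<Sum>\<rho>s \<in> bullet_factorizations \<pi>.
                (- 1) ^ (length \<rho>s + order \<pi>) * prod_list (map H \<rho>s))"

definition E :: "diagram \<Rightarrow> 'k::field parsym" where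
  "E \<pi> = prod_list (map E_irr (tensor_factors \<pi>))"

lemma E_empty: "E \<emptyset> = H \<emptyset>"
  by (simp add: E_def tensor_factors_eqI[of "[]"] H_empty)

lemma E_irreducible: "\<pi> \<noteq> \<emptyset> \<Longrightarrow> tensor_irreducible \<pi> \<Longrightarrow> E \<pi> = E_irr \<pi>"
  by (simp add: E_def tensor_factors_eqI[of "[\<pi>]"])

lemma E_tensor:
  assumes "\<forall>\<pi> \<in> set \<pi>s. \<pi> \<noteq> \<emptyset> \<and> tensor_irreducible \<pi>"
  shows "E (sum_list \<pi>s) = (prod_list (map E \<pi>s) :: 'k::field parsym)"
proof -
  have "map E \<pi>s = (map E_irr \<pi>s :: 'k parsym list)"
    using assms by (intro list.map_cong0 E_irreducible) auto
  then show ?thesis by (simp only: E_def[of "sum_list \<pi>s"] tensor_factors_eqI[OF assms refl])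
qed

end

(* The product \<otimes> adds up numbers of blocks, while \<bullet> merges two distinct blocks and so loses one.
   Hence every term of E_irr \<pi> other than \<plusminus>H \<pi> is indexed by a diagram with more blocks than \<pi>, and
   by multiplicativity the same holds for E \<pi>. The E therefore arise from the H by a triangular
   change of family with coefficients \<plusminus>1 on the diagonal. *)

theory Submission
  imports Defs
begin

section \<open>Block counts under \<otimes> and \<bullet>\<close>

lemma finite_blocks: "finite (blocks \<pi>)"
  using partition_on_blocks by (rule finite_elements[OF finite_vertices])

text \<open>A common block would be nonempty and lie both inside and outside
  \<open>vertices (order \<pi>)\<close>. This makes block counts additive and keeps the two blocks
  merged by \<bullet> distinct.\<close>

lemma blocks_disjoint_shifted: "blocks \<pi> \<inter> (`) (shift (order \<pi>)) ` blocks \<rho> = {}"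
proof (rule ccontr)
  assume "blocks \<pi> \<inter> (`) (shift (order \<pi>)) ` blocks \<rho> \<noteq> {}"
  then obtain Y where Y: "Y \<in> blocks \<rho>" "shift (order \<pi>) ` Y \<in> blocks \<pi>" by blast
  have "Y \<noteq> {}" "Y \<subseteq> vertices (order \<rho>)" "shift (order \<pi>) ` Y \<subseteq> vertices (order \<pi>)"
    using Y partition_onD1[OF partition_on_blocks[of \<rho>]]
      partition_onD3[OF partition_on_blocks[of \<rho>]] partition_onD1[OF partition_on_blocks[of \<pi>]]
    by auto
  then show False using shift_vertices[of "order \<pi>" "order \<rho>"] by blast
qed

lemma card_blocks_tensor: "card (blocks (\<pi> \<otimes> \<rho>)) = card (blocks \<pi>) + card (blocks \<rho>)"
proof -
  have "inj_on ((`) (shift (order \<pi>))) (blocks \<rho>)"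
    by (rule inj_onI) (simp add: inj_image_eq_iff[OF inj_shift])
  then show ?thesis
    unfolding blocks_tensor
    by (simp add: card_Un_disjoint finite_blocks blocks_disjoint_shifted card_image)
qed

text \<open>At least \<open>X\<close> and \<open>Y\<close> disappear and at most one new block
  appears.\<close>

lemma card_raw_merge_less:
  assumes "finite P" "X \<in> P" "Y \<in> P" "X \<noteq> Y" "u \<in> X" "v \<in> Y"
  shows "card (raw_merge u v P) < card P"
proof -
  have "card {Z \<in> P. u \<notin> Z \<and> v \<notin> Z} \<le> card (P - {X, Y})"
    using assms by (intro card_mono) auto
  also have "\<dots> = card P - 2" using assms by (simp add: card_Diff_subset)
  finally have "card (raw_merge u v P) \<le> card P - 2 + 1"
    unfolding raw_merge_def by (intro order_trans[OF card_Un_le]) simp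
  \<comment> \<open>The subtraction above is truncated; this yields
    \<open>2 \<le> card P\<close>.\<close>
  moreover have "card {X, Y} \<le> card P" using assms by (intro card_mono) auto
  ultimately show ?thesis using assms by simp
qed

text \<open>The first merged vertex lies in a block of \<pi>, the second is the shift of
  \<open>Inr 1\<close> and lies in a shifted block of \<rho>. These blocks differ, so the merge is
  proper.\<close>

lemma card_blocks_bullet_less:
  assumes "\<pi> \<noteq> \<emptyset>" "\<rho> \<noteq> \<emptyset>"
  shows "card (blocks (\<pi> \<bullet> \<rho>)) < card (blocks (\<pi> \<otimes> \<rho>))"
proof -
  have "order \<pi> \<noteq> 0" "order \<rho> \<noteq> 0" using assms order_eq_0_iff by auto
  then have "Inr (order \<pi>) \<in> \<Union> (blocks \<pi>)" "Inr 1 \<in> \<Union> (blocks \<rho>)"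
    unfolding partition_onD1[OF partition_on_blocks, symmetric] by auto
  then obtain X Y where X: "X \<in> blocks \<pi>" "Inr (order \<pi>) \<in> X" and Y: "Y \<in> blocks \<rho>" "Inr 1 \<in> Y"
    by blast
  have "Inr (order \<pi> + 1) \<in> shift (order \<pi>) ` Y"
    using Y(2) by (intro image_eqI[of _ _ "Inr 1"]) auto
  moreover have "X \<noteq> shift (order \<pi>) ` Y"
    using X(1) Y(1) blocks_disjoint_shifted[of \<pi> \<rho>] by blast
  ultimately show ?thesis
    unfolding blocks_bullet[OF assms] using X Y
    by (intro card_raw_merge_less[of _ X "shift (order \<pi>) ` Y"])
      (auto simp: finite_blocks blocks_tensor)
qed

text \<open>Each \<bullet> has fewer blocks than the corresponding \<otimes>, whose block count is
  additive. One-element lists give equality.\<close>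

lemma card_blocks_bullets_le:
  "\<rho>s \<noteq> [] \<Longrightarrow> \<forall>\<rho> \<in> set \<rho>s. \<rho> \<noteq> \<emptyset> \<Longrightarrow>
    card (blocks (bullets \<rho>s)) \<le> card (blocks (sum_list \<rho>s))"
proof (induction \<rho>s rule: bullets.induct)
  case (3 \<rho> \<sigma> \<rho>s)
  have "bullets (\<sigma> # \<rho>s) \<noteq> \<emptyset>" using bullets_order[of "\<sigma> # \<rho>s"] 3 by simp
  then have "card (blocks (\<rho> \<bullet> bullets (\<sigma> # \<rho>s))) < card (blocks (\<rho> \<otimes> bullets (\<sigma> # \<rho>s)))"
    using 3 by (intro card_blocks_bullet_less) auto
  then show ?case using 3 by (simp add: card_blocks_tensor)
qed auto

text \<open>The outermost \<bullet> makes the bound strict; the weak bound suffices for the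
  tail.\<close>

lemma card_blocks_bullets_less:
  assumes "\<forall>\<rho> \<in> set \<rho>s. \<rho> \<noteq> \<emptyset>" "2 \<le> length \<rho>s"
  shows "card (blocks (bullets \<rho>s)) < card (blocks (sum_list \<rho>s))"
proof -
  obtain \<rho> \<sigma> \<sigma>s where \<rho>s: "\<rho>s = \<rho> # \<sigma> # \<sigma>s"
    using assms(2) by (cases \<rho>s rule: bullets.cases) auto
  have "bullets (\<sigma> # \<sigma>s) \<noteq> \<emptyset>" using bullets_order[of "\<sigma> # \<sigma>s"] assms \<rho>s by simp
  then have "card (blocks (bullets \<rho>s)) < card (blocks (\<rho> \<otimes> bullets (\<sigma> # \<sigma>s)))"
    using assms \<rho>s by (simp add: card_blocks_bullet_less)
  also have "\<dots> \<le> card (blocks (sum_list \<rho>s))"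
    using card_blocks_bullets_le[of "\<sigma> # \<sigma>s"] assms \<rho>s by (simp add: card_blocks_tensor)
  finally show ?thesis .
qed

section \<open>Triangularity with respect to the number of blocks\<close>

lemma order_sum_list: "order (sum_list \<rho>s) = sum_list (map order \<rho>s)"
  by (induction \<rho>s) (simp_all add: order_tensor order_eq_0_iff)

text \<open>Fixing the order keeps the set finite, so its cardinality can serve as an induction
  measure. The strict inequality excludes \<pi> itself.\<close>

definition more_blocks :: "diagram \<Rightarrow> diagram set" where
  "more_blocks \<pi> = {\<sigma> \<in> A (order \<pi>). card (blocks \<pi>) < card (blocks \<sigma>)}"

lemma finite_more_blocks: "finite (more_blocks \<pi>)"
  by (simp add: more_blocks_def finite_A)

text \<open>The inclusion is strict because \<sigma> belongs to the larger set only.\<close>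

lemma more_blocks_psubset: "\<sigma> \<in> more_blocks \<pi> \<Longrightarrow> more_blocks \<sigma> \<subset> more_blocks \<pi>"
  by (auto simp: more_blocks_def A_iff_order)

text \<open>The only factorization of length one is \<open>[\<pi>]\<close>, so every other one
  involves a proper merge.\<close>

lemma sum_list_in_more_blocks:
  assumes "\<rho>s \<in> bullet_factorizations \<pi>" "\<rho>s \<noteq> [\<pi>]"
  shows "sum_list \<rho>s \<in> more_blocks \<pi>"
proof -
  have \<rho>s: "\<rho>s \<noteq> []" "\<forall>\<rho> \<in> set \<rho>s. \<rho> \<noteq> \<emptyset>" "bullets \<rho>s = \<pi>"
    using assms(1) by (auto simp: bullet_factorizations_def)
  then have "2 \<le> length \<rho>s" using assms(2) by (cases \<rho>s rule: bullets.cases) auto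
  then show ?thesis
    using card_blocks_bullets_less[OF \<rho>s(2)] bullets_order[OF \<rho>s(1,2)] \<rho>s(3)
    by (simp add: more_blocks_def A_iff_order order_sum_list)
qed

text \<open>As \<pi> is not in \<open>more_blocks \<pi>\<close>, the scalar \<open>c\<close> is the
  coefficient of \<open>H \<pi>\<close> in \<open>p\<close>. It may be zero here.\<close>

definition leading :: "'k::field \<Rightarrow> diagram \<Rightarrow> 'k parsym \<Rightarrow> bool" where
  "leading c \<pi> p \<longleftrightarrow> Poly_Mapping.keys (p - Poly_Mapping.single \<pi> c) \<subseteq> more_blocks \<pi>"

text \<open>Orders and block counts add under \<otimes>, so in the expanded product every term
  except the product of the leading terms has a factor with excess blocks.\<close>

lemma leading_mult:
  assumes "leading c \<pi> p" "leading d \<rho> q"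
  shows "leading (c * d) (\<pi> \<otimes> \<rho>) (p * q)"
proof -
  define x where "x = p - Poly_Mapping.single \<pi> c"
  define y where "y = q - Poly_Mapping.single \<rho> d"
  have pq: "p = Poly_Mapping.single \<pi> c + x" "q = Poly_Mapping.single \<rho> d + y"
    by (simp_all add: x_def y_def)
  have x: "Poly_Mapping.keys x \<subseteq> more_blocks \<pi>" and y: "Poly_Mapping.keys y \<subseteq> more_blocks \<rho>"
    using assms by (simp_all add: leading_def x_def y_def)
  \<comment> \<open>Only an inclusion, since the key set is empty for \<open>e = 0\<close>.\<close>
  have s: "Poly_Mapping.keys (Poly_Mapping.single \<tau> e) \<subseteq> {\<tau>}" for \<tau> :: diagram and e :: 'a
    by simp
  have mult: "Poly_Mapping.keys (f * g) \<subseteq> more_blocks (\<pi> \<otimes> \<rho>)"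
    if "Poly_Mapping.keys f \<subseteq> S" "Poly_Mapping.keys g \<subseteq> T"
      "\<And>a b. a \<in> S \<Longrightarrow> b \<in> T \<Longrightarrow> a \<otimes> b \<in> more_blocks (\<pi> \<otimes> \<rho>)" for f g :: "'a parsym" and S T
    using that keys_mult[of f g] by blast
  have "p * q - Poly_Mapping.single (\<pi> \<otimes> \<rho>) (c * d)
      = Poly_Mapping.single \<pi> c * y + x * Poly_Mapping.single \<rho> d + x * y"
    unfolding pq by (simp add: algebra_simps mult_single)
  moreover have "Poly_Mapping.keys (Poly_Mapping.single \<pi> c * y) \<subseteq> more_blocks (\<pi> \<otimes> \<rho>)"
    by (rule mult[OF s y]) (auto simp: more_blocks_def A_iff_order order_tensor card_blocks_tensor)
  moreover have "Poly_Mapping.keys (x * Poly_Mapping.single \<rho> d) \<subseteq> more_blocks (\<pi> \<otimes> \<rho>)"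
    by (rule mult[OF x s]) (auto simp: more_blocks_def A_iff_order order_tensor card_blocks_tensor)
  moreover have "Poly_Mapping.keys (x * y) \<subseteq> more_blocks (\<pi> \<otimes> \<rho>)"
    by (rule mult[OF x y]) (auto simp: more_blocks_def A_iff_order order_tensor card_blocks_tensor)
  ultimately show ?thesis
    unfolding leading_def
    using keys_add[of "Poly_Mapping.single \<pi> c * y + x * Poly_Mapping.single \<rho> d" "x * y"]
      keys_add[of "Poly_Mapping.single \<pi> c * y" "x * Poly_Mapping.single \<rho> d"]
    by (simp only:) blast
qed

lemma prod_list_H: "prod_list (map H \<rho>s) = H (sum_list \<rho>s)"
  by (induction \<rho>s) (simp_all add: H_empty H_mult)

text \<open>Turns a sign that is an element of the algebra into a scalar coefficient.\<close>

lemma minus_one_power_H: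
  "(- 1) ^ k * H \<pi> = Poly_Mapping.single \<pi> ((- 1) ^ k :: 'k::field)"
  by (cases "even k") (simp_all add: H_def single_uminus)

text \<open>The factorization \<open>[\<pi>]\<close>, of length 1, contributes the leading term; all
  others contribute diagrams with more blocks.\<close>

lemma leading_E_irr:
  assumes "\<pi> \<noteq> \<emptyset>"
  shows "leading ((- 1) ^ (1 + order \<pi>)) \<pi> (E_irr \<pi> :: 'k::field parsym)"
proof -
  let ?t = "\<lambda>\<rho>s. (- 1) ^ (length \<rho>s + order \<pi>) * prod_list (map H \<rho>s) :: 'k parsym"
  let ?F = "bullet_factorizations \<pi> - {[\<pi>]}"
  have "[\<pi>] \<in> bullet_factorizations \<pi>" using assms by (simp add: bullet_factorizations_def)
  then have "E_irr \<pi> = ?t [\<pi>] + sum ?t ?F"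
    unfolding E_irr_def by (rule sum.remove[OF finite_bullet_factorizations])
  moreover have "?t \<rho>s = Poly_Mapping.single (sum_list \<rho>s) ((- 1) ^ (length \<rho>s + order \<pi>))" for \<rho>s
    unfolding prod_list_H by (rule minus_one_power_H)
  ultimately have "E_irr \<pi> - Poly_Mapping.single \<pi> ((- 1) ^ (1 + order \<pi>))
      = (\<Sum>\<rho>s \<in> ?F. Poly_Mapping.single (sum_list \<rho>s) ((- 1) ^ (length \<rho>s + order \<pi>) :: 'k))"
    by (simp add: minus_one_power_H single_uminus)
  moreover have "Poly_Mapping.keys \<dots> \<subseteq> more_blocks \<pi>"
    by (rule subset_trans[OF keys_sum]) (use sum_list_in_more_blocks in auto)
  ultimately show ?thesis unfolding leading_def by simp
qed

text \<open>Leading coefficients multiply along the tensor factors, so the result is a product of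
  signs. Only its being nonzero is recorded, which suffices for division.\<close>

lemma leading_E: "\<exists>c. c \<noteq> 0 \<and> leading c \<pi> (E \<pi> :: 'k::field parsym)"
proof -
  have "\<exists>c. c \<noteq> 0 \<and> leading c (sum_list \<rho>s) (prod_list (map E_irr \<rho>s) :: 'k parsym)"
    if "\<forall>\<rho> \<in> set \<rho>s. \<rho> \<noteq> \<emptyset>" for \<rho>s
    using that
  proof (induction \<rho>s)
    case Nil
    show ?case by (intro exI[of _ 1]) (simp add: leading_def)
  next
    case (Cons \<rho> \<rho>s)
    then obtain c where c: "c \<noteq> 0"
      "leading c (sum_list \<rho>s) (prod_list (map E_irr \<rho>s) :: 'k parsym)"
      by auto
    have "leading ((- 1) ^ (1 + order \<rho>)) \<rho> (E_irr \<rho> :: 'k parsym)"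
      using Cons.prems by (intro leading_E_irr) simp
    from leading_mult[OF this c(2)] show ?case
      using c(1) by (intro exI[of _ "(- 1) ^ (1 + order \<rho>) * c"]) simp
  qed
  from this[of "tensor_factors \<pi>"] show ?thesis
    using tensor_factors[of \<pi>] unfolding E_def by auto
qed

section \<open>Passing between the families \<open>H\<close> and \<open>E\<close>\<close>

lemma parsym_eq_sum:
  "p = (\<Sum>\<sigma> \<in> Poly_Mapping.keys p. parsym_scale (Poly_Mapping.lookup p \<sigma>) (H \<sigma>))"
  by (rule poly_mapping_eqI)
    (simp add: lookup_sum lookup_parsym_scale H_def lookup_single when_def sum.delta
      in_keys_iff if_distrib cong: if_cong)

lemma in_subspace_if_keys:
  assumes "ParSym.subspace V" "\<And>\<sigma>. \<sigma> \<in> Poly_Mapping.keys p \<Longrightarrow> H \<sigma> \<in> V"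
  shows "p \<in> V"
  by (subst parsym_eq_sum) (intro ParSym.subspace_sum ParSym.subspace_scale assms)

lemma E_eq_H_plus:
  obtains c x where "c \<noteq> 0" "(E \<pi> :: 'k::field parsym) = parsym_scale c (H \<pi>) + x"
    "Poly_Mapping.keys x \<subseteq> more_blocks \<pi>"
proof -
  obtain c where c: "c \<noteq> 0" "leading c \<pi> (E \<pi> :: 'k parsym)" using leading_E by blast
  have "parsym_scale c (H \<pi>) = Poly_Mapping.single \<pi> c"
    by (rule poly_mapping_eqI) (simp add: lookup_parsym_scale H_def lookup_single when_def)
  with c show thesis
    by (intro that[of c "E \<pi> - Poly_Mapping.single \<pi> c"]) (simp_all add: leading_def)
qed

text \<open>Back substitution: the triangular relation is solved for \<open>H \<pi>\<close>, and the
  remainder involves only \<open>H \<sigma>\<close> with a smaller set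
  \<open>more_blocks \<sigma>\<close>.\<close>

lemma H_in_span_E: "(H \<pi> :: 'k::field parsym) \<in> ParSym.span (E ` A (order \<pi>))"
proof (induction "card (more_blocks \<pi>)" arbitrary: \<pi> rule: less_induct)
  case less
  let ?V = "ParSym.span (E ` A (order \<pi>)) :: 'k parsym set"
  obtain c x where c: "c \<noteq> 0" and E: "(E \<pi> :: 'k parsym) = parsym_scale c (H \<pi>) + x"
    and x: "Poly_Mapping.keys x \<subseteq> more_blocks \<pi>" by (rule E_eq_H_plus)
  have "x \<in> ?V"
  proof (rule in_subspace_if_keys[OF ParSym.subspace_span])
    fix \<sigma> assume "\<sigma> \<in> Poly_Mapping.keys x"
    then have \<sigma>: "\<sigma> \<in> more_blocks \<pi>" using x by blast
    \<comment> \<open>Equal orders make the span in the induction hypothesis for \<sigma> the same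
      as \<open>?V\<close>.\<close>
    then have "order \<sigma> = order \<pi>" by (simp add: more_blocks_def A_iff_order)
    then show "H \<sigma> \<in> ?V"
      using less[of \<sigma>] psubset_card_mono[OF finite_more_blocks more_blocks_psubset[OF \<sigma>]] by simp
  qed
  moreover have "E \<pi> \<in> ?V" by (intro ParSym.span_base imageI) (simp add: A_iff_order)
  ultimately have "parsym_scale (1 / c) (E \<pi> - x) \<in> ?V"
    by (intro ParSym.span_scale ParSym.span_diff)
  then show ?case using c by (simp add: E)
qed

lemma E_in_component: "(E \<pi> :: 'k::field parsym) \<in> ParSym_component (order \<pi>)"
proof -
  obtain c x where E: "(E \<pi> :: 'k parsym) = parsym_scale c (H \<pi>) + x"
    and x: "Poly_Mapping.keys x \<subseteq> more_blocks \<pi>" by (rule E_eq_H_plus)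
  have H: "(H \<sigma> :: 'k parsym) \<in> ParSym_component (order \<pi>)" if "order \<sigma> = order \<pi>" for \<sigma>
    unfolding ParSym_component_def
    by (intro ParSym.span_base imageI) (simp add: that A_iff_order)
  have V: "ParSym.subspace (ParSym_component (order \<pi>) :: 'k parsym set)"
    unfolding ParSym_component_def by (rule ParSym.subspace_span)
  have "x \<in> ParSym_component (order \<pi>)"
    by (rule in_subspace_if_keys[OF V], rule H) (use x in \<open>auto simp: more_blocks_def A_iff_order\<close>)
  then show ?thesis
    unfolding E by (intro ParSym.subspace_add[OF V] ParSym.subspace_scale[OF V] H refl)
qed

section \<open>Independence by a dimension count\<close>

lemma inj_H: "inj (H :: diagram \<Rightarrow> 'k::field parsym)"
proof (rule injI)
  fix \<pi> \<rho> assume "(H \<pi> :: 'k parsym) = H \<rho>"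
  from arg_cong[OF this, of "\<lambda>p. Poly_Mapping.lookup p \<pi>"] show "\<pi> = \<rho>"
    by (auto simp: H_def lookup_single when_def split: if_splits)
qed

text \<open>Reading off the coefficient at \<pi> in a vanishing combination isolates a single
  scalar. This gives the dimension of the component.\<close>

lemma independent_H:
  assumes "finite S"
  shows "ParSym.independent (H ` S :: 'k::field parsym set)"
proof
  assume "ParSym.dependent (H ` S :: 'k parsym set)"
  then obtain u \<pi> where \<pi>: "\<pi> \<in> S" "u (H \<pi>) \<noteq> 0"
    and "(\<Sum>v \<in> H ` S. parsym_scale (u v) v) = (0 :: 'k parsym)"
    using assms by (auto simp: ParSym.dependent_finite)
  then have "(\<Sum>\<sigma> \<in> S. parsym_scale (u (H \<sigma>)) (H \<sigma>)) = (0 :: 'k parsym)"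
    by (simp add: sum.reindex inj_on_subset[OF inj_H])
  from arg_cong[OF this, of "\<lambda>p. Poly_Mapping.lookup p \<pi>"] show False
    using \<pi> assms
    by (simp add: lookup_sum lookup_parsym_scale H_def lookup_single when_def sum.delta
        if_distrib cong: if_cong)
qed

theorem theorem3p14:
  fixes n :: nat
  shows "inj_on (E :: diagram \<Rightarrow> 'k::field parsym) (A n)
       \<and> ParSym.independent ((E :: diagram \<Rightarrow> 'k parsym) ` A n)
       \<and> ParSym.span ((E :: diagram \<Rightarrow> 'k parsym) ` A n) = ParSym_component n"
proof -
  let ?E = "E ` A n :: 'k parsym set" and ?H = "H ` A n :: 'k parsym set"
  have "?H \<subseteq> ParSym.span ?E" "?E \<subseteq> ParSym.span ?H"
    using H_in_span_E E_in_component by (fastforce simp: A_iff_order ParSym_component_def)+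
  then have span: "ParSym.span ?E = ParSym.span ?H"
    by (simp add: ParSym.span_eq)
  \<comment> \<open>A basis \<open>B\<close> is chosen inside \<open>?E\<close>; counting then shows
    that nothing was discarded.\<close>
  obtain B where B: "B \<subseteq> ?E" "ParSym.independent B" "?E \<subseteq> ParSym.span B"
    by (rule ParSym.maximal_independent_subset)
  have "ParSym.span B = ParSym.span ?H"
    using B(1,3) span ParSym.span_mono[OF B(1)] ParSym.span_minimal[OF B(3) ParSym.subspace_span]
    by blast
  \<comment> \<open>Both sets are independent with the same span, so both have its dimension as
    cardinality.\<close>
  then have "card B = card ?H"
    using ParSym.dim_span_eq_card_independent[OF B(2)]
      ParSym.dim_span_eq_card_independent[OF independent_H[OF finite_A]] by metis
  then have cB: "card B = card (A n)"
    by (simp add: card_image inj_on_subset[OF inj_H])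
  have fin: "finite ?E" by (simp add: finite_A)
  have le: "card B \<le> card ?E" by (rule card_mono[OF fin B(1)])
  have "card ?E \<le> card (A n)" by (rule card_image_le[OF finite_A])
  \<comment> \<open>The chain \<open>card (A n) = card B \<le> card ?E \<le> card (A n)\<close>
    collapses. Equality on the right gives injectivity of \<open>E\<close>, equality on the left
    gives \<open>B = ?E\<close>.\<close>
  then have cE: "card ?E = card (A n)" using le cB by simp
  then have "inj_on (E :: diagram \<Rightarrow> 'k parsym) (A n)"
    by (rule eq_card_imp_inj_on[OF finite_A])
  moreover have "B = ?E" using cE cB by (intro card_subset_eq[OF fin B(1)]) simp
  ultimately show ?thesis using B(2) span by (simp add: ParSym_component_def)
qed

end
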